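(* Let $k \ge 2$ be an even integer and let $D$ be an oriented graph with $\mathrm{inv}(D)=k$. Then $$\mathrm{inv}(\overrightarrow{C_3} \Rightarrow D)=\mathrm{inv}(\overrightarrow{C_3})+\mathrm{inv}(D)=1+k.$$
   Context: All digraphs are finite and have no loops, parallel arcs or 2-cycles (i.e. they are oriented graphs). $\overrightarrow{C_3}$ denotes the directed cycle on three vertices. For a digraph $D$ with vertex set $V(D)$ and a subset $X\subseteq V(D)$, the inversion of $X$ in $D$ is the digraph $\mathrm{Inv}(D;X)$ obtained from $D$ by reversing the direction of all arcs with both ends in $X$. For a finite family $(X_i)_{i\in I}$ of subsets of $V(D)$, $\mathrm{Inv}(D;(X_i)_{i\in I})$ is obtained by inverting the sets $X_i$ one after another (the order does not matter). The family is a decycling family if $\mathrm{Inv}(D;(X_i)_{i\in I})$ is acyclic. The inversion number $\mathrm{inv}(D)$ is the minimum cardinality $|I|$ of a decycling family of $D$. For (vertex-disjoint) oriented graphs $L,R$, the dijoin $L\Rightarrow R$ is the oriented graph obtained from the disjoint union of $L$ and $R$ by adding all arcs $uv$ with $u\in V(L)$, $v\in V(R)$. *)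

theory Defs
  imports "Graph_Theory.Pair_Digraph"
begin

text \<open>
  The locale \<^locale>\<open>pair_digraph\<close> provides finite digraphs without loops; parallel arcs are
  excluded because arcs are pairs of vertices.
\<close>

locale oriented_graph = pair_digraph G for G :: "'a pair_pre_digraph" +
  assumes no_2_cycle: "(u, v) \<in> parcs G \<Longrightarrow> (v, u) \<notin> parcs G"

definition acyclic_digraph :: "'a pair_pre_digraph \<Rightarrow> bool" where
  "acyclic_digraph D \<longleftrightarrow> \<not> (\<exists>p. pre_digraph.cycle (with_proj D) p)"

definition Inv :: "'a pair_pre_digraph \<Rightarrow> 'a set \<Rightarrow> 'a pair_pre_digraph" where
  "Inv D X = \<lparr> pverts = pverts D,
     parcs = {(u, v). (u, v) \<in> parcs D \<and> \<not> (u \<in> X \<and> v \<in> X)}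
           \<union> {(v, u) | u v. (u, v) \<in> parcs D \<and> u \<in> X \<and> v \<in> X} \<rparr>"

text \<open>
  A finite family of vertex sets is given as a list (repetitions are allowed); the cardinality
  of its index set is the length of the list.
\<close>

definition Inv_family :: "'a pair_pre_digraph \<Rightarrow> 'a set list \<Rightarrow> 'a pair_pre_digraph" where
  "Inv_family D Xs = fold (\<lambda>X G. Inv G X) Xs D"

definition decycling_family :: "'a pair_pre_digraph \<Rightarrow> 'a set list \<Rightarrow> bool" where
  "decycling_family D Xs \<longleftrightarrow>
     (\<forall>X \<in> set Xs. X \<subseteq> pverts D) \<and> acyclic_digraph (Inv_family D Xs)"

text \<open>
  The minimum exists for every oriented graph: fix a linear order of the vertices and invert
  the pair of ends of each arc that goes backwards.
\<close>

definition inversion_number :: "'a pair_pre_digraph \<Rightarrow> nat" where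
  "inversion_number D = (LEAST n. \<exists>Xs. decycling_family D Xs \<and> length Xs = n)"

definition directed_C3 :: "nat pair_pre_digraph" where
  "directed_C3 = \<lparr> pverts = {0, 1, 2}, parcs = {(0, 1), (1, 2), (2, 0)} \<rparr>"

text \<open>The sum type makes the two vertex sets disjoint.\<close>

definition dijoin ::
  "'a pair_pre_digraph \<Rightarrow> 'b pair_pre_digraph \<Rightarrow> ('a + 'b) pair_pre_digraph" where
  "dijoin L R = \<lparr> pverts = pverts L <+> pverts R,
     parcs = {(Inl u, Inl v) | u v. (u, v) \<in> parcs L}
           \<union> {(Inr u, Inr v) | u v. (u, v) \<in> parcs R}
           \<union> {(Inl u, Inr v) | u v. u \<in> pverts L \<and> v \<in> pverts R} \<rparr>"

end

theory Submission
  imports Defs "HOL-Library.Z2"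
begin

text \<open>
  Give each vertex the vector over the field with two elements that records to which sets of a
  family of inverted sets it belongs. An arc \<open>uv\<close> is reversed by the family if and only if the
  dot product of the vectors of \<open>u\<close> and \<open>v\<close> is 1. So the inversion number is the least dimension
  in which the vertices have vectors whose dot products make the digraph acyclic, and any change of
  the vectors that preserves the dot products is allowed.

  The upper bound is subadditivity: label the two sides of a dijoin in orthogonal coordinates.
  The lower bound holds for every digraph \<open>L\<close> with a cycle in place of the triangle. Let \<open>k\<close> be
  the inversion number of \<open>D\<close>, which is even, and suppose that vectors of dimension \<open>k\<close> make
  \<open>L \<Rightarrow> D\<close> acyclic. A vertex of \<open>L\<close> with vector \<open>p\<close> is joined to all of \<open>D\<close>, so the vertices \<open>v\<close> of
  \<open>D\<close> with \<open>p \<cdot> v = 1\<close> precede the other ones. Call such a set a prefix. Any two of these prefixes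
  are nested. Reversing all arcs inside a prefix keeps \<open>D\<close> acyclic
  (\<open>acyclic_switch_prefix\<close>), and this adds \<open>(p \<cdot> u)(p \<cdot> v)\<close> to the dot product of \<open>u\<close> and \<open>v\<close>.

  If \<open>p \<cdot> p = 1\<close>, then the new products are those of the orthogonal projections along \<open>p\<close>. As \<open>k\<close> is
  even, some coordinate of \<open>p\<close> is 0, and a transvection turns \<open>p\<close> into a unit vector. So the new
  products need only \<open>k - 1\<close> coordinates (\<open>drop_coordinate_odd\<close>), which contradicts the choice of
  \<open>k\<close>. Otherwise use an arc of \<open>L\<close> that is reversed, which exists because \<open>L\<close> has a cycle. Its
  ends have vectors \<open>p\<close> and \<open>q\<close> with \<open>p \<cdot> q = 1\<close> and \<open>p \<cdot> p = q \<cdot> q = 0\<close>. Projecting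
  along the plane that they span adds \<open>(p \<cdot> u)(q \<cdot> v) + (q \<cdot> u)(p \<cdot> v)\<close>. This also leaves an acyclic
  digraph (\<open>acyclic_switch_nested_prefixes\<close>) and again saves a coordinate
  (\<open>drop_coordinate_hyperbolic\<close>).
\<close>

\<comment> \<open>Sums and products of bits are to be normalised by the ring laws, not as Boolean operations.\<close>
declare add_bit_eq_xor [simp del] mult_bit_eq_and [simp del]

lemma bit_add_self: "(x::bit) + x = 0" "x + (x + y) = y"
  by (cases x; cases y; simp)+

lemma bit_mult_self: "(x::bit) * x = x" "x * (x * y) = x * y"
  by (cases x; simp)+

section \<open>Vectors over the field with two elements\<close>

definition dot :: "'i set \<Rightarrow> ('i \<Rightarrow> bit) \<Rightarrow> ('i \<Rightarrow> bit) \<Rightarrow> bit" where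
  "dot I x y = (\<Sum>i\<in>I. x i * y i)"

lemma dot_commute: "dot I x y = dot I y x"
  by (simp add: dot_def mult.commute)

lemma dot_add_left: "dot I (\<lambda>i. x i + y i) z = dot I x z + dot I y z"
  by (simp add: dot_def distrib_right sum.distrib)

lemma dot_add_right: "dot I z (\<lambda>i. x i + y i) = dot I z x + dot I z y"
  by (simp add: dot_def distrib_left sum.distrib)

lemma dot_scale_left: "dot I (\<lambda>i. c * x i) z = c * dot I x z"
  by (simp add: dot_def sum_distrib_left mult.assoc)

lemma dot_scale_right: "dot I z (\<lambda>i. c * x i) = c * dot I z x"
  by (simp add: dot_def sum_distrib_left mult.left_commute)

lemmas dot_linear = dot_add_left dot_add_right dot_scale_left dot_scale_right

lemma dot_unit:
  assumes "finite I" "i \<in> I"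
  shows "dot I x (\<lambda>j. of_bool (j = i)) = x i" "dot I (\<lambda>j. of_bool (j = i)) x = x i"
proof -
  have "dot I x (\<lambda>j. of_bool (j = i)) = (\<Sum>j\<in>I. if j = i then x j else 0)"
    unfolding dot_def by (intro sum.cong) auto
  then show "dot I x (\<lambda>j. of_bool (j = i)) = x i" using assms by simp
  then show "dot I (\<lambda>j. of_bool (j = i)) x = x i" by (simp add: dot_commute)
qed

text \<open>
  The all-ones vector has self-product \<open>card K\<close>, which vanishes in characteristic 2. This is the
  point at which the parity of the inversion number enters.
\<close>

lemma odd_vector_has_zero:
  assumes "even (card K)" "dot K a a = 1"
  shows "\<exists>i\<in>K. a i = 0"
proof (rule ccontr)
  assume "\<not> ?thesis"
  then have "dot K a a = (\<Sum>i\<in>K. 1)"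
    unfolding dot_def by (intro sum.cong) auto
  also have "\<dots> = of_nat (card K)" by simp
  also have "\<dots> = 0" using assms(1) by (auto elim!: evenE)
  finally show False using assms(2) by simp
qed

text \<open>
  With a zero coordinate \<open>i\<close> of \<open>a\<close> and the unit vector \<open>e\<close> at \<open>i\<close>, the vector \<open>w = a + e\<close> is
  isotropic, so the transvection along \<open>w\<close> preserves dot products. It maps \<open>a\<close> to \<open>e\<close>. Hence the
  \<open>i\<close>-th coordinate of the image of \<open>x\<close> is \<open>a \<cdot> x\<close>, and to drop it is to subtract
  \<open>(a \<cdot> x)(a \<cdot> y)\<close>, which in characteristic 2 is to add it.
\<close>

lemma drop_coordinate_odd:
  assumes fin: "finite K" and ev: "even (card K)" and odd: "dot K a a = 1"
  obtains i g where "i \<in> K"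
    "\<And>x y. dot (K - {i}) (g x) (g y) = dot K x y + dot K a x * dot K a y"
proof -
  from odd_vector_has_zero[OF ev odd] obtain i where i: "i \<in> K" "a i = 0" by blast
  define e :: "'a \<Rightarrow> bit" where "e = (\<lambda>j. of_bool (j = i))"
  define w where "w = (\<lambda>j. a j + e j)"
  define g where "g = (\<lambda>x j. x j + dot K w x * w j)"
  have e: "dot K e x = x i" "dot K x e = x i" for x
    unfolding e_def using dot_unit[OF fin i(1)] by auto
  have wx: "dot K w x = dot K a x + x i" for x
    by (simp add: w_def dot_linear e)
  have ww: "dot K w w = 0"
    by (simp add: w_def dot_linear e odd i(2)) (simp add: e_def)
  have iso: "dot K (g x) (g y) = dot K x y" for x y
    unfolding g_def dot_linear by (simp add: ww dot_commute[of K x w] algebra_simps bit_add_self)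
  have gi: "g x i = dot K a x" for x
    by (simp add: g_def wx) (simp add: w_def e_def i(2) algebra_simps bit_add_self)
  have "dot K (g x) (g y) = g x i * g y i + dot (K - {i}) (g x) (g y)" for x y
    unfolding dot_def by (rule sum.remove[OF fin i(1)])
  then have "dot (K - {i}) (g x) (g y) = dot K x y + dot K a x * dot K a y" for x y
    by (metis (no_types, lifting) add.commute bit_add_self(2) iso gi)
  with i(1) that show thesis by blast
qed

text \<open>
  Adding \<open>(q \<cdot> x) p + (p \<cdot> x) q\<close> to \<open>x\<close> is the orthogonal projection along the hyperbolic plane of
  \<open>p\<close> and \<open>q\<close>, and gives the stated products. The coefficient of \<open>p\<close> may be chosen freely, because
  \<open>p\<close> is isotropic and orthogonal to the projected vectors. It is chosen to make the image
  orthogonal to an odd vector \<open>a\<close>, along which a coordinate can then be dropped at no cost. The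
  restriction of \<open>p\<close> to the zeros of \<open>q\<close> serves as \<open>a\<close>: it is odd because
  \<open>p \<cdot> p + p \<cdot> q = 1\<close>.
\<close>

lemma drop_coordinate_hyperbolic:
  assumes fin: "finite K" and ev: "even (card K)"
    and pp: "dot K p p = 0" and qq: "dot K q q = 0" and pq: "dot K p q = 1"
  obtains i g where "i \<in> K"
    "\<And>x y. dot (K - {i}) (g x) (g y)
              = dot K x y + (dot K p x * dot K q y + dot K q x * dot K p y)"
proof -
  define a where "a = (\<lambda>i. p i * (1 + q i))"
  have aa: "dot K a a = dot K p p + dot K p q" and ap: "dot K a p = dot K p p + dot K p q"
    and aq: "dot K a q = dot K p q + dot K p q"
    unfolding dot_def a_def sum.distrib[symmetric]
    by (auto intro!: sum.cong simp: algebra_simps bit_mult_self bit_add_self)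
  have aa: "dot K a a = 1" and ap: "dot K a p = 1" and aq: "dot K a q = 0"
    using aa ap aq pp pq by (simp_all add: bit_add_self)
  define h where "h = (\<lambda>x j. x j + (dot K a x * p j + dot K p x * q j))"
  have ah: "dot K a (h x) = 0" for x
    by (simp add: h_def dot_linear ap aq bit_add_self)
  have hh: "dot K (h x) (h y)
      = dot K x y + (dot K p x * dot K q y + dot K q x * dot K p y)" for x y
    unfolding h_def dot_linear
    by (simp add: pp qq pq dot_commute[of K q p] dot_commute[of K x p] dot_commute[of K x q]
        algebra_simps bit_add_self)
  obtain i g where "i \<in> K"
    "\<And>x y. dot (K - {i}) (g x) (g y) = dot K x y + dot K a x * dot K a y"
    using drop_coordinate_odd[OF fin ev aa] by metis
  then show thesis
    using that[of i "\<lambda>x. g (h x)"] by (simp add: ah hh)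
qed

section \<open>Switching the arcs of a relation\<close>

definition switch :: "'a rel \<Rightarrow> ('a \<Rightarrow> 'a \<Rightarrow> bit) \<Rightarrow> 'a rel" where
  "switch R c = {(u, v). if c u v = 1 then (v, u) \<in> R else (u, v) \<in> R}"

lemma switch_iff: "(u, v) \<in> switch R c \<longleftrightarrow> (if c u v = 1 then (v, u) \<in> R else (u, v) \<in> R)"
  by (simp add: switch_def)

lemma switch_zero [simp]: "switch R (\<lambda>u v. 0) = R"
  by (simp add: switch_def)

lemma switch_switch:
  assumes "\<And>u v. c u v = c v u"
  shows "switch (switch R c) d = switch R (\<lambda>u v. c u v + d u v)"
proof -
  have "(u, v) \<in> switch (switch R c) d \<longleftrightarrow> (u, v) \<in> switch R (\<lambda>u v. c u v + d u v)" for u v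
    using assms[of u v] by (cases "c u v"; cases "d u v") (auto simp: switch_iff)
  then show ?thesis by auto
qed

lemma finite_switch: "finite R \<Longrightarrow> finite (switch R c)"
  by (rule finite_subset[of _ "R \<union> R\<inverse>"]) (auto simp: switch_def split: if_splits)

lemma acyclic_ranking:
  assumes "finite R" "acyclic R"
  obtains r :: "'a \<Rightarrow> nat" where "\<And>u v. (u, v) \<in> R \<Longrightarrow> r u < r v"
proof -
  define r where "r v = card {w. (w, v) \<in> R\<^sup>+}" for v
  have "r u < r v" if "(u, v) \<in> R" for u v
    unfolding r_def
  proof (rule psubset_card_mono)
    have "{w. (w, v) \<in> R\<^sup>+} \<subseteq> fst ` (R\<^sup>+)" by force
    then show "finite {w. (w, v) \<in> R\<^sup>+}"
      using assms(1) by (meson finite_imageI finite_subset finite_trancl)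
    show "{w. (w, u) \<in> R\<^sup>+} \<subset> {w. (w, v) \<in> R\<^sup>+}"
      using that assms(2) by (auto simp: acyclic_def)
  qed
  then show thesis by (rule that)
qed

text \<open>
  In an acyclic order in which the set \<open>s = 1\<close> comes first, listing this set in the opposite order is
  again acyclic once the arcs inside it are reversed.
\<close>

lemma acyclic_switch_prefix:
  fixes s :: "'a \<Rightarrow> bit"
  assumes fin: "finite R" and ac: "acyclic (switch R c)"
    and sym: "\<And>u v. c u v = c v u"
    and prefix: "\<And>u v. (u, v) \<in> switch R c \<Longrightarrow> s v = 1 \<Longrightarrow> s u = 1"
  shows "acyclic (switch R (\<lambda>u v. c u v + s u * s v))"
proof -
  obtain r :: "'a \<Rightarrow> nat" where r: "\<And>u v. (u, v) \<in> switch R c \<Longrightarrow> r u < r v"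
    using acyclic_ranking[OF finite_switch[OF fin] ac] by blast
  \<comment> \<open>Negation reverses the prefix; the shift by 1 keeps rank 0 apart from the other vertices.\<close>
  define r' :: "'a \<Rightarrow> int" where "r' u = (if s u = 1 then - 1 - int (r u) else int (r u))" for u
  have "r' u < r' v" if uv: "(u, v) \<in> switch R (\<lambda>u v. c u v + s u * s v)" for u v
  proof (cases "s u = 1 \<and> s v = 1")
    case True
    then have "(v, u) \<in> switch R c"
      using uv sym[of u v] by (cases "c u v") (auto simp: switch_iff)
    with True r show ?thesis by (simp add: r'_def)
  next
    case False
    then have "s u * s v = 0" by (metis bit_not_zero_iff mult_zero_left mult_zero_right)
    then have "(u, v) \<in> switch R c"
      using uv by (simp add: switch_iff)
    with False r[of u v] prefix[of u v] show ?thesis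
      by (cases "s u"; cases "s v") (auto simp: r'_def)
  qed
  then show ?thesis
    by (intro acyclicI_order[where f = "\<lambda>u. - r' u"]) simp
qed

text \<open>
  The order consists of the block \<open>A\<close> where \<open>p = q = 1\<close>, then the block \<open>B\<close> where only \<open>q = 1\<close>,
  then the rest, and the switch swaps \<open>A\<close> with \<open>B\<close>. Like every exchange of adjacent blocks, this is
  a product of three reversals: of \<open>A\<close>, of \<open>AB\<close>, and of \<open>B\<close>, each of which is a prefix at its
  turn. Algebraically, \<open>pp\<^sup>T + qq\<^sup>T + (p + q)(p + q)\<^sup>T = pq\<^sup>T + qp\<^sup>T\<close>.
\<close>

lemma acyclic_switch_nested_prefixes:
  fixes p q :: "'a \<Rightarrow> bit"
  assumes fin: "finite R" and ac: "acyclic (switch R c)"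
    and sym: "\<And>u v. c u v = c v u"
    and p: "\<And>u v. (u, v) \<in> switch R c \<Longrightarrow> p v = 1 \<Longrightarrow> p u = 1"
    and q: "\<And>u v. (u, v) \<in> switch R c \<Longrightarrow> q v = 1 \<Longrightarrow> q u = 1"
    and nested: "\<And>u. u \<in> Field R \<Longrightarrow> p u = 1 \<Longrightarrow> q u = 1"
  shows "acyclic (switch R (\<lambda>u v. c u v + (p u * q v + q u * p v)))"
proof -
  let ?c1 = "\<lambda>u v. c u v + p u * p v"
  let ?c2 = "\<lambda>u v. ?c1 u v + q u * q v"
  let ?c3 = "\<lambda>u v. ?c2 u v + (p u + q u) * (p v + q v)"
  have arc_kept: "(u, v) \<in> switch R c"
    if "(u, v) \<in> switch R (\<lambda>u v. c u v + d u v)" "d u v = 0" for u v d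
    using that by (simp add: switch_iff)
  have arc_reversed: "(v, u) \<in> switch R c"
    if "(u, v) \<in> switch R (\<lambda>u v. c u v + d u v)" "d u v = 1" for u v d
    using that sym[of u v] by (cases "c u v") (auto simp: switch_iff)
  have field: "u \<in> Field R \<and> v \<in> Field R" if "(u, v) \<in> switch R d" for u v d
    using that by (auto simp: switch_def Field_def split: if_splits)
  have ac1: "acyclic (switch R ?c1)"
    by (rule acyclic_switch_prefix[OF fin ac sym p])
  have ac2: "acyclic (switch R ?c2)"
  proof (rule acyclic_switch_prefix[OF fin ac1])
    fix u v assume uv: "(u, v) \<in> switch R ?c1" and v: "q v = 1"
    show "q u = 1"
    proof (rule ccontr)
      assume "q u \<noteq> 1"
      with nested field[OF uv] have "p u = 0" by (metis bit_not_one_iff)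
      then have "(u, v) \<in> switch R c" using arc_kept[OF uv] by simp
      with q v \<open>q u \<noteq> 1\<close> show False by blast
    qed
  qed (simp add: sym mult.commute)
  have ac3: "acyclic (switch R ?c3)"
  proof (rule acyclic_switch_prefix[OF fin ac2])
    fix u v assume uv: "(u, v) \<in> switch R ?c2" and v: "p v + q v = 1"
    have v': "p v = 0" "q v = 1"
      using v nested[of v] field[OF uv] by (cases "p v"; cases "q v"; simp)+
    show "p u + q u = 1"
    proof (rule ccontr)
      assume "p u + q u \<noteq> 1"
      then consider "p u = 0" "q u = 0" | "p u = 1" "q u = 1"
        by (cases "p u"; cases "q u") auto
      then show False
      proof cases
        case 1
        then have "(u, v) \<in> switch R c"
          using arc_kept[of u v "\<lambda>u v. p u * p v + q u * q v"] uv by (simp add: add.assoc)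
        with q v' 1 show False by fastforce
      next
        case 2
        then have "(v, u) \<in> switch R c"
          using arc_reversed[of u v "\<lambda>u v. p u * p v + q u * q v"] uv v' by (simp add: add.assoc)
        with p v' 2 show False by fastforce
      qed
    qed
  qed (simp add: sym mult.commute)
  have "?c3 u v = c u v + (p u * q v + q u * p v)" for u v
    by (simp add: algebra_simps bit_add_self)
  with ac3 show ?thesis by simp
qed

section \<open>Decycling families as vertex labellings\<close>

definition acyclic_labelling :: "'a rel \<Rightarrow> 'i set \<Rightarrow> ('a \<Rightarrow> 'i \<Rightarrow> bit) \<Rightarrow> bool" where
  "acyclic_labelling R I f \<longleftrightarrow> acyclic (switch R (\<lambda>u v. dot I (f u) (f v)))"

lemma acyclic_digraph_iff:
  assumes "pair_wf_digraph G"
  shows "acyclic_digraph G \<longleftrightarrow> acyclic (parcs G)"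
proof -
  interpret pair_wf_digraph G by fact
  have "(\<exists>p. cycle p) \<longleftrightarrow> (\<exists>u p. awalk u p u \<and> p \<noteq> [])"
    using closed_w_imp_cycle by (auto simp: closed_w_def cycle_def)
  also have "\<dots> \<longleftrightarrow> (\<exists>u. (u, u) \<in> (parcs G)\<^sup>+)"
    using reachable1_awalk by simp
  finally show ?thesis by (simp add: acyclic_digraph_def acyclic_def)
qed

lemma Inv_family_Cons: "Inv_family D (X # Xs) = Inv_family (Inv D X) Xs"
  by (simp add: Inv_family_def)

lemma pverts_Inv_family: "pverts (Inv_family D Xs) = pverts D"
  by (induction Xs arbitrary: D) (simp_all add: Inv_family_Cons, simp_all add: Inv_family_def Inv_def)

lemma parcs_Inv: "parcs (Inv D X) = switch (parcs D) (\<lambda>u v. of_bool (u \<in> X \<and> v \<in> X))"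
  by (auto simp: Inv_def switch_def)

lemma parcs_Inv_family:
  "parcs (Inv_family D Xs) = switch (parcs D) (\<lambda>u v. \<Sum>X\<leftarrow>Xs. of_bool (u \<in> X \<and> v \<in> X))"
proof (induction Xs arbitrary: D)
  case Nil
  then show ?case by (simp add: Inv_family_def)
next
  case (Cons X Xs)
  then show ?case
    by (simp add: Inv_family_Cons parcs_Inv switch_switch conj_commute)
qed

lemma acyclic_Inv_family_iff:
  assumes "pair_wf_digraph D"
  shows "acyclic_digraph (Inv_family D Xs) \<longleftrightarrow>
    acyclic (switch (parcs D) (\<lambda>u v. \<Sum>X\<leftarrow>Xs. of_bool (u \<in> X \<and> v \<in> X)))"
proof -
  interpret pair_wf_digraph D by fact
  have "pair_wf_digraph (Inv_family D Xs)"
    by unfold_locales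
      (auto simp: pverts_Inv_family parcs_Inv_family switch_def wellformed' split: if_splits)
  then show ?thesis by (simp add: acyclic_digraph_iff parcs_Inv_family)
qed

text \<open>
  A family with fewer than \<open>n\<close> sets is padded with zero coordinates.
\<close>

lemma labelling_of_family:
  assumes "pair_wf_digraph D" "decycling_family D Xs" "length Xs \<le> n"
  obtains f :: "'a \<Rightarrow> nat \<Rightarrow> bit" where "acyclic_labelling (parcs D) {..<n} f"
proof -
  define f :: "'a \<Rightarrow> nat \<Rightarrow> bit" where "f u i = of_bool (i < length Xs \<and> u \<in> Xs ! i)" for u i
  have "(\<Sum>X\<leftarrow>Xs. of_bool (u \<in> X \<and> v \<in> X)) = dot {..<n} (f u) (f v)" for u v
  proof -
    have "(\<Sum>X\<leftarrow>Xs. of_bool (u \<in> X \<and> v \<in> X) :: bit)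
        = (\<Sum>i<length Xs. of_bool (u \<in> Xs ! i \<and> v \<in> Xs ! i))"
      by (simp add: sum_list_sum_nth atLeast0LessThan)
    also have "\<dots> = (\<Sum>i<length Xs. f u i * f v i)"
      by (rule sum.cong) (auto simp: f_def)
    also have "\<dots> = dot {..<n} (f u) (f v)"
      unfolding dot_def using assms(3) by (intro sum.mono_neutral_left) (auto simp: f_def)
    finally show ?thesis .
  qed
  with assms(1,2) have "acyclic_labelling (parcs D) {..<n} f"
    by (simp add: decycling_family_def acyclic_Inv_family_iff acyclic_labelling_def)
  then show thesis by (rule that)
qed

text \<open>
  Each coordinate is one inverted set, so any finite index set may serve in place of an initial
  segment of the natural numbers.
\<close>

lemma family_of_labelling:
  assumes "pair_wf_digraph D" "finite I" "acyclic_labelling (parcs D) I f"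
  obtains Xs where "decycling_family D Xs" "length Xs = card I"
proof -
  interpret pair_wf_digraph D by fact
  obtain js where js: "set js = I" "distinct js" using finite_distinct_list[OF assms(2)] by blast
  define Xs where "Xs = map (\<lambda>i. {v \<in> pverts D. f v i = 1}) js"
  have sum_eq: "(\<Sum>X\<leftarrow>Xs. of_bool (u \<in> X \<and> v \<in> X)) = dot I (f u) (f v)"
    if "u \<in> pverts D" "v \<in> pverts D" for u v
  proof -
    have "(\<Sum>X\<leftarrow>Xs. of_bool (u \<in> X \<and> v \<in> X) :: bit)
        = (\<Sum>i\<in>I. of_bool (f u i = 1 \<and> f v i = 1))"
      using js that by (simp add: Xs_def o_def sum_list_distinct_conv_sum_set)
    also have "\<dots> = dot I (f u) (f v)"
      unfolding dot_def
    proof (rule sum.cong)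
      fix i show "of_bool (f u i = 1 \<and> f v i = 1) = f u i * f v i"
        by (cases "f u i"; cases "f v i") auto
    qed simp
    finally show ?thesis .
  qed
  have same: "switch (parcs D) (\<lambda>u v. \<Sum>X\<leftarrow>Xs. of_bool (u \<in> X \<and> v \<in> X))
      = switch (parcs D) (\<lambda>u v. dot I (f u) (f v))"
    by (auto simp: switch_def sum_eq wellformed' split: if_splits)
  have "acyclic_digraph (Inv_family D Xs)"
    using assms(3) unfolding acyclic_Inv_family_iff[OF assms(1)] same acyclic_labelling_def .
  moreover have "\<forall>X\<in>set Xs. X \<subseteq> pverts D" by (auto simp: Xs_def)
  ultimately have "decycling_family D Xs" by (simp add: decycling_family_def)
  moreover have "length Xs = card I"
    using distinct_card[OF js(2)] js(1) by (simp add: Xs_def)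
  ultimately show thesis by (rule that)
qed

lemma inversion_number_le:
  assumes "pair_wf_digraph D" "finite I" "acyclic_labelling (parcs D) I f"
  shows "inversion_number D \<le> card I"
proof -
  obtain Xs where "decycling_family D Xs" "length Xs = card I"
    using family_of_labelling[OF assms] .
  then show ?thesis unfolding inversion_number_def by (intro Least_le exI conjI)
qed

lemma oriented_graph_wf: "oriented_graph D \<Longrightarrow> pair_wf_digraph D"
  unfolding oriented_graph_def pair_digraph_def pair_fin_digraph_def by (elim conjE)

lemma oriented_graph_finite_arcs: "oriented_graph D \<Longrightarrow> finite (parcs D)"
  unfolding oriented_graph_def pair_digraph_def by (blast dest: pair_fin_digraph.pair_finite_arcs)

text \<open>
  Label with one coordinate for each arc that goes backwards in a fixed enumeration \<open>e\<close> of the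
  vertices, and put a 1 at both of its ends. Two ends of an arc share a coordinate only if that arc
  is backward, since there are no 2-cycles.
\<close>

lemma decycling_family_exists:
  assumes "oriented_graph D"
  obtains Xs where "decycling_family D Xs"
proof -
  interpret oriented_graph D by fact
  obtain e :: "'a \<Rightarrow> nat" where e: "inj_on e (pverts D)"
    using finite_imp_inj_to_nat_seg[OF pair_finite_verts] by blast
  define B where "B = {(u, v) \<in> parcs D. e v < e u}"
  define f :: "'a \<Rightarrow> 'a \<times> 'a \<Rightarrow> bit" where "f w b = of_bool (w = fst b \<or> w = snd b)" for w b
  have fin: "finite B"
    unfolding B_def by (rule finite_subset[OF _ pair_finite_arcs]) auto
  have dot: "dot B (f u) (f v) = of_bool ((u, v) \<in> B)" if uv: "(u, v) \<in> parcs D" for u v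
  proof -
    have "dot B (f u) (f v) = (\<Sum>b\<in>B. if b = (u, v) then 1 else 0)"
      unfolding dot_def
    proof (rule sum.cong)
      fix b assume "b \<in> B"
      then show "f u b * f v b = (if b = (u, v) then 1 else 0)"
        using no_2_cycle[OF uv] pair_no_loops[OF uv] pair_no_loops[of b]
        by (cases b) (auto simp: f_def B_def)
    qed simp
    then show ?thesis using fin by simp
  qed
  have "e u < e v" if "(u, v) \<in> switch (parcs D) (\<lambda>u v. dot B (f u) (f v))" for u v
  proof (cases "dot B (f u) (f v) = 1")
    case True
    then have vu: "(v, u) \<in> parcs D" using that by (simp add: switch_iff)
    with dot[OF vu] True show ?thesis by (simp add: dot_commute B_def)
  next
    case False
    then have uv: "(u, v) \<in> parcs D" using that by (simp add: switch_iff)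
    then have "e u \<noteq> e v"
      using e pair_no_loops[OF uv] by (auto simp: inj_on_def wellformed')
    with False dot[OF uv] uv show ?thesis by (auto simp: B_def)
  qed
  then have "acyclic_labelling (parcs D) B f"
    unfolding acyclic_labelling_def
    by (intro acyclicI_order[where f = "\<lambda>u. - int (e u)"]) simp
  then obtain Xs where "decycling_family D Xs"
    by (rule family_of_labelling[OF pair_wf_digraph_axioms fin])
  then show thesis by (rule that)
qed

lemma labelling_exists:
  assumes "oriented_graph D" "inversion_number D \<le> n"
  obtains f :: "'a \<Rightarrow> nat \<Rightarrow> bit" where "acyclic_labelling (parcs D) {..<n} f"
proof -
  obtain Xs where "decycling_family D Xs" using decycling_family_exists[OF assms(1)] .
  then have "\<exists>n Xs. decycling_family D Xs \<and> length Xs = n" by blast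
  then have "\<exists>Xs. decycling_family D Xs \<and> length Xs = inversion_number D"
    unfolding inversion_number_def by (rule LeastI_ex)
  then obtain Xs where Xs: "decycling_family D Xs" "length Xs \<le> n" using assms(2) by auto
  show thesis by (rule labelling_of_family[OF oriented_graph_wf[OF assms(1)] Xs that])
qed

lemma inversion_number_eq_0_iff:
  assumes "oriented_graph D"
  shows "inversion_number D = 0 \<longleftrightarrow> acyclic (parcs D)"
proof
  assume "inversion_number D = 0"
  then have "inversion_number D \<le> 0" by simp
  then obtain f :: "'a \<Rightarrow> nat \<Rightarrow> bit" where "acyclic_labelling (parcs D) {..<0} f"
    by (rule labelling_exists[OF assms])
  then show "acyclic (parcs D)" by (simp add: acyclic_labelling_def dot_def)
next
  assume "acyclic (parcs D)"
  then have "acyclic_labelling (parcs D) {} (\<lambda>_ _. 0)"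
    by (simp add: acyclic_labelling_def dot_def)
  from inversion_number_le[OF oriented_graph_wf[OF assms] finite.emptyI this]
  show "inversion_number D = 0" by simp
qed

section \<open>Dijoins\<close>

lemma parcs_dijoin [simp]:
  "(Inl u, Inl v) \<in> parcs (dijoin L R) \<longleftrightarrow> (u, v) \<in> parcs L"
  "(Inr x, Inr y) \<in> parcs (dijoin L R) \<longleftrightarrow> (x, y) \<in> parcs R"
  "(Inl u, Inr x) \<in> parcs (dijoin L R) \<longleftrightarrow> u \<in> pverts L \<and> x \<in> pverts R"
  "(Inr x, Inl u) \<notin> parcs (dijoin L R)"
  by (auto simp: dijoin_def)

lemma oriented_graph_dijoin:
  assumes "oriented_graph L" "oriented_graph R"
  shows "oriented_graph (dijoin L R)"
proof -
  interpret L: oriented_graph L by fact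
  interpret R: oriented_graph R by fact
  have pv: "pverts (dijoin L R) = pverts L <+> pverts R" by (simp add: dijoin_def)
  have wf: "u \<in> pverts (dijoin L R) \<and> v \<in> pverts (dijoin L R) \<and> u \<noteq> v
      \<and> (v, u) \<notin> parcs (dijoin L R)" if "(u, v) \<in> parcs (dijoin L R)" for u v
    using that L.wellformed' R.wellformed' L.no_2_cycle R.no_2_cycle
    by (cases u; cases v) (auto simp: pv dest: L.pair_no_loops R.pair_no_loops)
  have fin: "finite (pverts (dijoin L R))"
    using L.pair_finite_verts R.pair_finite_verts by (simp add: pv)
  moreover have "parcs (dijoin L R) \<subseteq> pverts (dijoin L R) \<times> pverts (dijoin L R)"
    using wf by auto
  ultimately have "finite (parcs (dijoin L R))"
    by (meson finite_SigmaI finite_subset)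
  then show ?thesis
    using fin wf by unfold_locales (auto simp: split_paired_all)
qed

text \<open>
  The coordinates used by \<open>L\<close> vanish on \<open>R\<close> and conversely, so the arcs from \<open>L\<close> to \<open>R\<close> are kept,
  and an acyclic order of \<open>L\<close> followed by one of \<open>R\<close> is acyclic for the dijoin.
\<close>

lemma inversion_number_dijoin_le:
  assumes L: "oriented_graph L" and R: "oriented_graph R"
  shows "inversion_number (dijoin L R) \<le> inversion_number L + inversion_number R"
proof -
  let ?l = "{..<inversion_number L}" and ?r = "{..<inversion_number R}"
  obtain f :: "_ \<Rightarrow> nat \<Rightarrow> bit" where f: "acyclic_labelling (parcs L) ?l f"
    using labelling_exists[OF L order_refl] .
  obtain g :: "_ \<Rightarrow> nat \<Rightarrow> bit" where g: "acyclic_labelling (parcs R) ?r g"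
    using labelling_exists[OF R order_refl] .
  obtain r1 :: "_ \<Rightarrow> nat" where r1:
    "\<And>u v. (u, v) \<in> switch (parcs L) (\<lambda>u v. dot ?l (f u) (f v)) \<Longrightarrow> r1 u < r1 v"
    using f acyclic_ranking[OF finite_switch[OF oriented_graph_finite_arcs[OF L]]]
    unfolding acyclic_labelling_def by metis
  obtain r2 :: "_ \<Rightarrow> nat" where r2:
    "\<And>u v. (u, v) \<in> switch (parcs R) (\<lambda>u v. dot ?r (g u) (g v)) \<Longrightarrow> r2 u < r2 v"
    using g acyclic_ranking[OF finite_switch[OF oriented_graph_finite_arcs[OF R]]]
    unfolding acyclic_labelling_def by metis
  define h where "h = case_sum (\<lambda>u. case_sum (f u) (\<lambda>_. 0)) (\<lambda>x. case_sum (\<lambda>_. 0) (g x))"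
  have dot: "dot (?l <+> ?r) (h (Inl u)) (h (Inl v)) = dot ?l (f u) (f v)"
    "dot (?l <+> ?r) (h (Inr x)) (h (Inr y)) = dot ?r (g x) (g y)"
    "dot (?l <+> ?r) (h (Inl u)) (h (Inr y)) = 0"
    "dot (?l <+> ?r) (h (Inr x)) (h (Inl v)) = 0" for u v x y
    by (simp_all add: dot_def h_def sum.Plus)
  have "acyclic_labelling (parcs (dijoin L R)) (?l <+> ?r) h"
    unfolding acyclic_labelling_def
  proof (rule acyclicI_order)
    \<comment> \<open>The ranks of \<open>L\<close> are shifted below 0, so that they precede those of \<open>R\<close>.\<close>
    define r3 where "r3 = case_sum (\<lambda>u. int (r1 u) - int (Max (r1 ` pverts L)) - 1) (\<lambda>x. int (r2 x))"
    fix u v assume uv: "(u, v) \<in> switch (parcs (dijoin L R)) (\<lambda>u v. dot (?l <+> ?r) (h u) (h v))"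
    have le: "r1 x \<le> Max (r1 ` pverts L)" if "x \<in> pverts L" for x
      using that L by (simp add: oriented_graph_def pair_digraph_def pair_fin_digraph.pair_finite_verts)
    show "- r3 v < - r3 u"
      using uv r1 r2 le unfolding r3_def
      by (cases u; cases v) (fastforce simp: switch_iff dot split: if_splits)+
  qed
  then have "inversion_number (dijoin L R) \<le> card (?l <+> ?r)"
    by (intro inversion_number_le oriented_graph_wf oriented_graph_dijoin L R) auto
  then show ?thesis by (simp add: card_Plus)
qed

context
  fixes L :: "'l pair_pre_digraph" and R :: "'r pair_pre_digraph" and I :: "'i set"
    and f :: "'l + 'r \<Rightarrow> 'i \<Rightarrow> bit"
  assumes ac: "acyclic_labelling (parcs (dijoin L R)) I f"
begin

abbreviation (input) join_arcs :: "('l + 'r) rel" where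
  "join_arcs \<equiv> switch (parcs (dijoin L R)) (\<lambda>u v. dot I (f u) (f v))"

lemma no_closed_walk: "(u, u) \<notin> join_arcs\<^sup>+"
  using ac by (simp add: acyclic_labelling_def acyclic_def)

lemma labelling_right: "acyclic_labelling (parcs R) I (\<lambda>x. f (Inr x))"
proof -
  obtain T where T: "T = switch (parcs R) (\<lambda>x y. dot I (f (Inr x)) (f (Inr y)))" by blast
  have "(Inr x, Inr y) \<in> join_arcs\<^sup>+" if "(x, y) \<in> T\<^sup>+" for x y
    using that
  proof induction
    case (base y)
    then show ?case by (intro r_into_trancl) (simp add: T switch_iff)
  next
    case (step y z)
    have "(Inr y, Inr z) \<in> join_arcs" using step by (simp add: T switch_iff)
    with step.IH show ?case by (rule trancl_into_trancl)
  qed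
  with no_closed_walk show ?thesis
    unfolding acyclic_labelling_def acyclic_def T[symmetric] by blast
qed

lemma join_arc_to_right:
  "p \<in> pverts L \<Longrightarrow> x \<in> pverts R \<Longrightarrow> dot I (f (Inl p)) (f (Inr x)) = 0
    \<Longrightarrow> (Inl p, Inr x) \<in> join_arcs"
  by (simp add: switch_iff)

lemma join_arc_to_left:
  "p \<in> pverts L \<Longrightarrow> x \<in> pverts R \<Longrightarrow> dot I (f (Inl p)) (f (Inr x)) = 1
    \<Longrightarrow> (Inr x, Inl p) \<in> join_arcs"
  by (simp add: switch_iff dot_commute)

text \<open>
  A violation would be a closed walk \<open>p \<rightarrow> x \<rightarrow> y \<rightarrow> p\<close>.
\<close>

lemma left_vertex_prefix:
  assumes "pair_wf_digraph R" and p: "p \<in> pverts L"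
    and xy: "(x, y) \<in> switch (parcs R) (\<lambda>x y. dot I (f (Inr x)) (f (Inr y)))"
    and y: "dot I (f (Inl p)) (f (Inr y)) = 1"
  shows "dot I (f (Inl p)) (f (Inr x)) = 1"
proof (rule ccontr)
  assume "\<not> ?thesis"
  then have x: "dot I (f (Inl p)) (f (Inr x)) = 0" by simp
  have "x \<in> pverts R" "y \<in> pverts R"
    using xy pair_wf_digraph.wellformed'[OF assms(1)] by (auto simp: switch_iff split: if_splits)
  then have "(Inl p, Inr x) \<in> join_arcs" "(Inr y, Inl p) \<in> join_arcs"
    using join_arc_to_right join_arc_to_left p x y by auto
  moreover have "(Inr x, Inr y) \<in> join_arcs" using xy by (simp add: switch_iff)
  ultimately show False
    using no_closed_walk by (meson r_into_trancl' trancl_into_trancl)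
qed

text \<open>
  A vertex \<open>x\<close> in the prefix of \<open>p\<close> only and a vertex \<open>y\<close> in that of \<open>q\<close> only would give the closed
  walk \<open>x \<rightarrow> p \<rightarrow> y \<rightarrow> q \<rightarrow> x\<close>.
\<close>

lemma left_vertices_nested:
  assumes "p \<in> pverts L" "q \<in> pverts L"
  shows "(\<forall>x\<in>pverts R. dot I (f (Inl p)) (f (Inr x)) = 1 \<longrightarrow> dot I (f (Inl q)) (f (Inr x)) = 1) \<or>
    (\<forall>x\<in>pverts R. dot I (f (Inl q)) (f (Inr x)) = 1 \<longrightarrow> dot I (f (Inl p)) (f (Inr x)) = 1)"
proof (rule ccontr)
  assume "\<not> ?thesis"
  then obtain x y where "x \<in> pverts R" "y \<in> pverts R"
    "dot I (f (Inl p)) (f (Inr x)) = 1" "dot I (f (Inl q)) (f (Inr x)) = 0"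
    "dot I (f (Inl q)) (f (Inr y)) = 1" "dot I (f (Inl p)) (f (Inr y)) = 0"
    by auto
  then have "(Inr x, Inl p) \<in> join_arcs" "(Inl q, Inr x) \<in> join_arcs"
    "(Inr y, Inl q) \<in> join_arcs" "(Inl p, Inr y) \<in> join_arcs"
    using join_arc_to_right join_arc_to_left assms by auto
  then show False
    using no_closed_walk by (meson r_into_trancl' trancl_into_trancl)
qed

text \<open>
  If no arc of \<open>L\<close> were reversed, a cycle of \<open>L\<close> would survive.
\<close>

lemma left_arc_switched:
  assumes "\<not> acyclic (parcs L)"
  obtains p q where "(p, q) \<in> parcs L" "dot I (f (Inl p)) (f (Inl q)) = 1"
proof (rule ccontr)
  assume "\<not> thesis"
  with that have 0: "dot I (f (Inl p)) (f (Inl q)) = 0" if "(p, q) \<in> parcs L" for p q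
    using that by (metis bit_not_one_iff)
  have "(Inl p, Inl q) \<in> join_arcs\<^sup>+" if "(p, q) \<in> (parcs L)\<^sup>+" for p q
    using that
  proof induction
    case (base y)
    then show ?case by (intro r_into_trancl) (simp add: switch_iff 0)
  next
    case (step y z)
    have "(Inl y, Inl z) \<in> join_arcs" using step by (simp add: switch_iff 0)
    with step.IH show ?case by (rule trancl_into_trancl)
  qed
  with no_closed_walk assms show False unfolding acyclic_def by blast
qed

end

text \<open>
  The prefix reversals on the digraph side are matched with the projections on the vector side: both
  change the dot products by the same bilinear term.
\<close>

lemma labelling_drop_coordinate:
  assumes L: "oriented_graph L" and R: "oriented_graph R" and cyc: "\<not> acyclic (parcs L)"
    and fin: "finite K" and ev: "even (card K)"
    and ac: "acyclic_labelling (parcs (dijoin L R)) K f"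
  obtains i g where "i \<in> K" "acyclic_labelling (parcs R) (K - {i}) g"
proof -
  let ?x = "\<lambda>p. f (Inl p)" and ?y = "\<lambda>u. f (Inr u)"
  let ?c = "\<lambda>u v. dot K (?y u) (?y v)"
  let ?s = "\<lambda>p u. dot K (?x p) (?y u)"
  note result = that
  note finR = oriented_graph_finite_arcs[OF R] and wfR = oriented_graph_wf[OF R]
    and wfL = oriented_graph_wf[OF L]
  have acR: "acyclic (switch (parcs R) ?c)"
    using labelling_right[OF ac] by (simp add: acyclic_labelling_def)
  have sym: "?c u v = ?c v u" for u v by (rule dot_commute)
  have prefix: "?s p u = 1"
    if "p \<in> pverts L" "(u, v) \<in> switch (parcs R) ?c" "?s p v = 1" for p u v
    using left_vertex_prefix[OF ac wfR] that by blast
  have odd_case: thesis if p: "p \<in> pverts L" "dot K (?x p) (?x p) = 1" for p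
  proof -
    obtain i g where ig: "i \<in> K" "\<And>x y. dot (K - {i}) (g x) (g y)
        = dot K x y + dot K (?x p) x * dot K (?x p) y"
      using drop_coordinate_odd[OF fin ev p(2)] by metis
    have "acyclic (switch (parcs R) (\<lambda>u v. ?c u v + ?s p u * ?s p v))"
      by (rule acyclic_switch_prefix[OF finR acR sym prefix[OF p(1)]])
    then show thesis
      using result[of i "\<lambda>u. g (?y u)"] ig by (simp add: acyclic_labelling_def)
  qed
  have even_case: thesis
    if pq: "p \<in> pverts L" "q \<in> pverts L" "dot K (?x p) (?x p) = 0" "dot K (?x q) (?x q) = 0"
      "dot K (?x p) (?x q) = 1"
      and nested: "\<forall>u\<in>pverts R. ?s p u = 1 \<longrightarrow> ?s q u = 1" for p q
  proof -
    obtain i g where ig: "i \<in> K" "\<And>x y. dot (K - {i}) (g x) (g y) = dot K x y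
        + (dot K (?x p) x * dot K (?x q) y + dot K (?x q) x * dot K (?x p) y)"
      using drop_coordinate_hyperbolic[OF fin ev pq(3-5)] by metis
    have "Field (parcs R) \<subseteq> pverts R"
      using pair_wf_digraph.wellformed'[OF wfR] by (auto simp: Field_def)
    with nested have "acyclic (switch (parcs R)
        (\<lambda>u v. ?c u v + (?s p u * ?s q v + ?s q u * ?s p v)))"
      by (intro acyclic_switch_nested_prefixes[OF finR acR sym prefix[OF pq(1)] prefix[OF pq(2)]])
        auto
    then show thesis
      using result[of i "\<lambda>u. g (?y u)"] ig by (simp add: acyclic_labelling_def)
  qed
  obtain p q where pq: "(p, q) \<in> parcs L" "dot K (?x p) (?x q) = 1"
    using left_arc_switched[OF ac cyc] by metis
  then have vs: "p \<in> pverts L" "q \<in> pverts L"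
    using pair_wf_digraph.wellformed'[OF wfL] by auto
  show thesis
  proof (cases "dot K (?x p) (?x p) = 1 \<or> dot K (?x q) (?x q) = 1")
    case True
    with odd_case vs show thesis by blast
  next
    case False
    then have "dot K (?x p) (?x p) = 0" "dot K (?x q) (?x q) = 0" by auto
    moreover have "dot K (?x q) (?x p) = 1" using pq(2) by (simp add: dot_commute)
    ultimately show thesis
      using left_vertices_nested[OF ac vs] even_case[OF vs] even_case[OF vs(2,1)] pq(2) by blast
  qed
qed

theorem inversion_number_dijoin_greater:
  assumes L: "oriented_graph L" and R: "oriented_graph R"
    and cyc: "inversion_number L \<noteq> 0" and ev: "even (inversion_number R)"
  shows "inversion_number R < inversion_number (dijoin L R)"
proof (rule ccontr)
  let ?K = "{..<inversion_number R}"
  assume "\<not> ?thesis"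
  then have "inversion_number (dijoin L R) \<le> inversion_number R" by simp
  then obtain f :: "_ \<Rightarrow> nat \<Rightarrow> bit" where f: "acyclic_labelling (parcs (dijoin L R)) ?K f"
    by (rule labelling_exists[OF oriented_graph_dijoin[OF L R]])
  have "\<not> acyclic (parcs L)" using cyc by (simp add: inversion_number_eq_0_iff[OF L])
  moreover have "even (card ?K)" using ev by simp
  ultimately obtain i g where i: "i \<in> ?K" and g: "acyclic_labelling (parcs R) (?K - {i}) g"
    using labelling_drop_coordinate[OF L R _ finite_lessThan _ f] by metis
  have "inversion_number R \<le> card (?K - {i})"
    by (rule inversion_number_le[OF oriented_graph_wf[OF R] _ g]) simp
  also have "\<dots> < card ?K" using i by (intro card_Diff1_less) auto
  finally show False by simp
qed

section \<open>The directed triangle\<close>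

lemma oriented_graph_directed_C3: "oriented_graph directed_C3"
  by unfold_locales (auto simp: directed_C3_def)

lemma inversion_number_directed_C3: "inversion_number directed_C3 = 1"
proof (rule antisym)
  \<comment> \<open>Inverting the set of 0 and 1 leaves the order 1, 2, 0.\<close>
  define f :: "nat \<Rightarrow> unit \<Rightarrow> bit" where "f v i = of_bool (v \<noteq> 2)" for v i
  have "acyclic_labelling (parcs directed_C3) {()} f"
    unfolding acyclic_labelling_def
    by (rule acyclicI_order[where f = "\<lambda>v::nat. if v = 1 then 2 else if v = 2 then 1 else 0 :: nat"])
      (auto simp: switch_iff directed_C3_def dot_def f_def split: if_splits)
  then show "inversion_number directed_C3 \<le> 1"
    using inversion_number_le[OF oriented_graph_wf[OF oriented_graph_directed_C3], of "{()}" f]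
    by simp
  have "(0, 0) \<in> (parcs directed_C3)\<^sup>+"
    unfolding directed_C3_def
    by (rule trancl_into_trancl[OF trancl_into_trancl[OF r_into_trancl]]) auto
  then have "\<not> acyclic (parcs directed_C3)" unfolding acyclic_def by blast
  then show "1 \<le> inversion_number directed_C3"
    using inversion_number_eq_0_iff[OF oriented_graph_directed_C3] by simp
qed

theorem theorem1p7:
  fixes k :: nat and D :: "'a pair_pre_digraph"
  assumes "k \<ge> 2" and "even k"
    and "oriented_graph D"
    and "inversion_number D = k"
  shows "inversion_number (dijoin directed_C3 D)
           = inversion_number directed_C3 + inversion_number D
       \<and> inversion_number directed_C3 + inversion_number D = 1 + k"
proof -
  note C3 = oriented_graph_directed_C3 inversion_number_directed_C3
  have "inversion_number (dijoin directed_C3 D) \<le> 1 + k"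
    using inversion_number_dijoin_le[OF C3(1) assms(3)] C3(2) assms(4) by simp
  moreover have "k < inversion_number (dijoin directed_C3 D)"
    using inversion_number_dijoin_greater[OF C3(1) assms(3)] C3(2) assms(2,4) by simp
  ultimately show ?thesis using C3(2) assms(4) by simp
qed

end
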